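(* Let $p\in(1,2)$. There exist constants $c,C>0$ depending only on $p$ such that the following holds. Let $n,m\ge1$ be integers, let $\xi_1,\dots,\xi_n$ be independent copies of a $\log$-$\gamma_{1,2}$ distributed random variable $\xi$ on a probability space $(\Omega_1,\mathfrak{A}_1,\mathbb{P}_1)$, and let $\eta_1,\dots,\eta_m$ be independent copies of a $p$-stable random variable $\eta$ on a probability space $(\Omega_2,\mathfrak{A}_2,\mathbb{P}_2)$. Then, for all real matrices $(a_{ij})_{i,j}\in\mathbb{R}^{n\times m}$, $$c\left(\sum_{j=1}^m\Big(\sum_{i=1}^n|a_{ij}|^2\Big)^{p/2}\right)^{1/p}\le \mathbb{E}_{\Omega_1}\mathbb{E}_{\Omega_2}\max_{1\le i\le n,\,1\le j\le m}\left|a_{ij}\,\eta_j(\omega_2)\,\xi_i(\omega_1)\right|\le C\left(\sum_{j=1}^m\Big(\sum_{i=1}^n|a_{ij}|^2\Big)^{p/2}\right)^{1/p}.$$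
   Context: $\mathbb{E}_{\Omega_k}$ denotes expectation (integration) over $(\Omega_k,\mathfrak{A}_k,\mathbb{P}_k)$ in the variable $\omega_k$, $k=1,2$. For parameters $q,r>0$, a random variable is $\log$-$\gamma_{q,r}$ distributed if it has density $f(x)=\frac{r^q}{\Gamma(q)}x^{-r-1}(\ln x)^{q-1}$ for $x\ge1$ and $f(x)=0$ for $x<1$; in particular the $\log$-$\gamma_{1,2}$ density is $2x^{-3}$ on $[1,\infty)$. For $p\in(1,2)$, a $p$-stable random variable means a (symmetric, normalized) real random variable $X$ with characteristic function $\mathbb{E}e^{itX}=e^{-|t|^p}$ for all $t\in\mathbb{R}$. *)

theory Defs
  imports "HOL-Probability.Probability"
begin

text \<open>
  The library sets \<open>0 powr 0 = 0\<close>, so for \<open>q = 1\<close> the value at the single point \<open>x = 1\<close> is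
  \<open>0\<close> instead of \<open>r\<close>; as a density with respect to \<open>lborel\<close> this makes no difference.
\<close>
definition log_gamma_density :: "real \<Rightarrow> real \<Rightarrow> real \<Rightarrow> real" where
  "log_gamma_density q r x =
     (if 1 \<le> x then r powr q / Gamma q * x powr (- r - 1) * (ln x) powr (q - 1) else 0)"

definition log_gamma_distributed :: "'a measure \<Rightarrow> real \<Rightarrow> real \<Rightarrow> ('a \<Rightarrow> real) \<Rightarrow> bool" where
  "log_gamma_distributed M q r X \<longleftrightarrow>
     distributed M lborel X (\<lambda>x. ennreal (log_gamma_density q r x))"

definition p_stable :: "'a measure \<Rightarrow> real \<Rightarrow> ('a \<Rightarrow> real) \<Rightarrow> bool" where
  "p_stable M p X \<longleftrightarrow>
     X \<in> borel_measurable M \<and>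
     (\<forall>t. char (distr M borel X) t = complex_of_real (exp (- (\<bar>t\<bar> powr p))))"

lemma log_gamma_density_1_2:
  "1 < x \<Longrightarrow> log_gamma_density 1 2 x = 2 * x powr (- 3)"
  by (simp add: log_gamma_density_def)

text \<open>
  The expectations of the nonnegative maximum are taken in \<open>[0, \<infinity>]\<close>, so the upper bound
  asserts in particular that they are finite. The two type arguments are the types of the sample
  points of the two probability spaces. HOL cannot quantify over types inside a formula, so
  \<open>\<exists>c>0. \<exists>C>0. max_estimate TYPE('a) TYPE('b) p c C\<close> alone would let the constants vary with
  \<open>'a\<close> and \<open>'b\<close>. To express constants depending on \<open>p\<close> only, one chooses them for the sample type
  \<open>nat \<Rightarrow> real\<close> (rich enough for every joint law of the variables) and requires that all
  constants valid there are valid for arbitrary types \<open>'a\<close> and \<open>'b\<close>.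
\<close>
definition max_estimate :: "'a itself \<Rightarrow> 'b itself \<Rightarrow> real \<Rightarrow> real \<Rightarrow> real \<Rightarrow> bool" where
  "max_estimate T1 T2 p c C \<longleftrightarrow>
     (\<forall>(n::nat) (m::nat) (M1 :: 'a measure) (M2 :: 'b measure)
        (\<xi> :: nat \<Rightarrow> 'a \<Rightarrow> real) (\<eta> :: nat \<Rightarrow> 'b \<Rightarrow> real) (a :: nat \<Rightarrow> nat \<Rightarrow> real).
        1 \<le> n \<longrightarrow> 1 \<le> m \<longrightarrow>
        prob_space M1 \<longrightarrow> prob_space M2 \<longrightarrow>
        prob_space.indep_vars M1 (\<lambda>_. borel) \<xi> {1..n} \<longrightarrow>
        (\<forall>i\<in>{1..n}. log_gamma_distributed M1 1 2 (\<xi> i)) \<longrightarrow>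
        prob_space.indep_vars M2 (\<lambda>_. borel) \<eta> {1..m} \<longrightarrow>
        (\<forall>j\<in>{1..m}. p_stable M2 p (\<eta> j)) \<longrightarrow>
        (let N = (\<Sum>j=1..m. (\<Sum>i=1..n. \<bar>a i j\<bar>\<^sup>2) powr (p / 2)) powr (1 / p);
             E = (\<integral>\<^sup>+ \<omega>1. (\<integral>\<^sup>+ \<omega>2.
                    ennreal (Max ((\<lambda>(i, j). \<bar>a i j * \<eta> j \<omega>2 * \<xi> i \<omega>1\<bar>) ` ({1..n} \<times> {1..m})))
                    \<partial>M2) \<partial>M1)
         in ennreal (c * N) \<le> E \<and> E \<le> ennreal (C * N)))"

end

theory Submission
  imports Defs
begin

text \<open>
  The estimate rests on a principle about variables with power tails: if
  \<open>P(X\<^sub>j > x)\<close> is comparable to \<open>x powr (- q)\<close> and \<open>q > 1\<close>, then \<open>E (max\<^sub>j b\<^sub>j X\<^sub>j)\<close> is comparable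
  to the \<open>\<ell>\<^sub>q\<close>-norm of \<open>b\<close>. The upper bound (\<open>nn_integral_Max_le\<close>) is a union bound, the lower bound
  (\<open>nn_integral_Max_ge\<close>) uses independence: at the level of the norm itself the individual
  exceedance probabilities add up to a constant.

  A \<open>p\<close>-stable variable has tails of order \<open>x powr (- p)\<close>; both halves of this are read off from the
  behaviour \<open>1 - exp (- (\<bar>t\<bar> powr p)) \<approx> \<bar>t\<bar> powr p\<close> of its characteristic function near \<open>0\<close>
  (\<open>p_stable_tail_le\<close>, \<open>p_stable_tail_ge\<close>). A \<open>log\<close>-\<open>\<gamma>\<^sub>1\<^sub>,\<^sub>2\<close> variable has the tail \<open>x powr (- 2)\<close> for
  \<open>x \<ge> 1\<close>.

  Freeze \<open>\<omega>\<^sub>1\<close> and put \<open>B\<^sub>j = max\<^sub>i \<bar>a\<^sub>i\<^sub>j \<xi>\<^sub>i\<bar>\<close>. The principle with \<open>q = p\<close> turns the inner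
  expectation into the \<open>\<ell>\<^sub>p\<close>-norm of \<open>B\<close>, up to constants. It remains to integrate this norm over \<open>\<omega>\<^sub>1\<close> and
  to compare it with the \<open>\<ell>\<^sub>p\<close>-norm of the vector of column norms
  \<open>\<beta>\<^sub>j = (\<Sum>\<^sub>i a\<^sub>i\<^sub>j\<^sup>2)\<^sup>1\<^sup>/\<^sup>2\<close>. From above, the expectation is moved inside the concave \<open>p\<close>-th root, and the
  principle is applied to the powers \<open>\<bar>\<xi>\<^sub>i\<bar> powr p\<close>, whose tail exponent is \<open>2 / p > 1\<close>; this requires
  \<open>p < 2\<close> (\<open>log_gamma_mixed_norm_le\<close>). From below, the norm is minorised by a linear
  functional which almost norms \<open>\<beta>\<close>, and the principle with \<open>q = 2\<close> gives \<open>E B\<^sub>j \<ge> const * \<beta>\<^sub>j\<close>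
  (\<open>log_gamma_mixed_norm_ge\<close>).

  That constants valid for one type of sample points are valid for all types holds because the iterated
  expectation and the hypotheses on the variables depend on the joint laws only, and these live on \<open>nat \<Rightarrow> real\<close> (\<open>max_estimate_transfer\<close>).
\<close>

section \<open>Maxima of random variables with power tails\<close>

lemma (in prob_space) nn_integral_layer_cake:
  fixes Y :: "'a \<Rightarrow> real" and g :: "real \<Rightarrow> ennreal"
  assumes [measurable]: "Y \<in> borel_measurable M" "g \<in> borel_measurable borel"
  shows "(\<integral>\<^sup>+\<omega>. (\<integral>\<^sup>+t. g t * indicator {..<Y \<omega>} t \<partial>lborel) \<partial>M) =
         (\<integral>\<^sup>+t. g t * emeasure M {\<omega> \<in> space M. t < Y \<omega>} \<partial>lborel)"
proof -
  interpret pair_sigma_finite M lborel ..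
  have [measurable]: "Measurable.pred (M \<Otimes>\<^sub>M borel) (\<lambda>x. snd x \<in> {..<Y (fst x)})"
    unfolding lessThan_iff by measurable
  have "(\<integral>\<^sup>+\<omega>. (\<integral>\<^sup>+t. g t * indicator {..<Y \<omega>} t \<partial>lborel) \<partial>M) =
        (\<integral>\<^sup>+t. (\<integral>\<^sup>+\<omega>. g t * indicator {..<Y \<omega>} t \<partial>M) \<partial>lborel)"
    by (rule Fubini'[symmetric]) measurable
  also have "\<dots> = (\<integral>\<^sup>+t. g t * emeasure M {\<omega> \<in> space M. t < Y \<omega>} \<partial>lborel)"
  proof (rule nn_integral_cong)
    fix t :: real
    have "(\<integral>\<^sup>+\<omega>. g t * indicator {..<Y \<omega>} t \<partial>M) =
          (\<integral>\<^sup>+\<omega>. g t * indicator {\<omega> \<in> space M. t < Y \<omega>} \<omega> \<partial>M)"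
      by (rule nn_integral_cong) (auto split: split_indicator)
    also have "\<dots> = g t * emeasure M {\<omega> \<in> space M. t < Y \<omega>}"
      by (subst nn_integral_cmult_indicator) auto
    finally show "(\<integral>\<^sup>+\<omega>. g t * indicator {..<Y \<omega>} t \<partial>M) = g t * emeasure M {\<omega> \<in> space M. t < Y \<omega>}" .
  qed
  finally show ?thesis .
qed

lemma nn_integral_powr_atLeast:
  fixes q s :: real
  assumes "1 < q" "0 < s"
  shows "(\<integral>\<^sup>+t. ennreal (t powr - q) * indicator {s..} t \<partial>lborel) = ennreal (s powr (1 - q) / (q - 1))"
proof -
  have "(\<integral>\<^sup>+t. ennreal (t powr - q) * indicator {s..} t \<partial>lborel) =
      ennreal (0 - (- (s powr (1 - q) / (q - 1))))"
  proof (rule nn_integral_FTC_atLeast)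
    fix x assume "s \<le> x"
    then have "0 < x" using assms by simp
    have "((\<lambda>x. - 1 / (q - 1) * x powr (1 - q)) has_real_derivative
        - 1 / (q - 1) * ((1 - q) * x powr (1 - q - 1))) (at x)"
      using \<open>0 < x\<close> by (intro DERIV_cmult has_real_derivative_powr)
    moreover have "- 1 / (q - 1) * ((1 - q) * y) = y" for y using assms by (simp add: field_simps)
    ultimately show "((\<lambda>x. - (x powr (1 - q) / (q - 1))) has_real_derivative x powr - q) (at x)"
      by simp
  next
    show "((\<lambda>x. - (x powr (1 - q) / (q - 1))) \<longlongrightarrow> 0) at_top"
    proof -
      have "((\<lambda>x. - (x powr (1 - q) / (q - 1))) \<longlongrightarrow> - (0 / (q - 1))) at_top"
        using assms by (intro tendsto_intros tendsto_neg_powr filterlim_ident) auto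
      then show ?thesis by simp
    qed
  qed (use assms in auto)
  then show ?thesis by simp
qed

text \<open>
  The excess of \<open>b X\<close> over a level \<open>s\<close> has expectation \<open>\<integral>\<^sub>s\<^sup>\<infinity> P(b X > t) dt\<close>. As \<open>ennreal\<close> maps negative
  reals to \<open>0\<close>, the term \<open>ennreal (b * X \<omega> - s)\<close> is the positive part.
\<close>

lemma (in prob_space) nn_integral_excess_le:
  fixes X :: "'a \<Rightarrow> real"
  assumes [measurable]: "X \<in> borel_measurable M"
    and q: "1 < q" and K: "0 \<le> K" and b: "0 \<le> b" and s: "0 < s"
    and tail: "\<And>x. 0 < x \<Longrightarrow> measure M {\<omega> \<in> space M. x < X \<omega>} \<le> K * x powr - q"
  shows "(\<integral>\<^sup>+\<omega>. ennreal (b * X \<omega> - s) \<partial>M) \<le> ennreal (K / (q - 1) * b powr q * s powr (1 - q))"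
proof -
  have "(\<integral>\<^sup>+\<omega>. ennreal (b * X \<omega> - s) \<partial>M) =
        (\<integral>\<^sup>+\<omega>. (\<integral>\<^sup>+t. indicator {s..} t * indicator {..<b * X \<omega>} t \<partial>lborel) \<partial>M)"
  proof (rule nn_integral_cong)
    fix \<omega>
    have "(\<integral>\<^sup>+t. indicator {s..} t * indicator {..<b * X \<omega>} t \<partial>lborel) =
          (\<integral>\<^sup>+t. indicator {s..<b * X \<omega>} t \<partial>lborel)"
      by (rule nn_integral_cong) (auto split: split_indicator)
    also have "\<dots> = ennreal (b * X \<omega> - s)"
      by (cases "s \<le> b * X \<omega>") (auto simp: ennreal_neg)
    finally show "ennreal (b * X \<omega> - s) = (\<integral>\<^sup>+t. indicator {s..} t * indicator {..<b * X \<omega>} t \<partial>lborel)" ..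
  qed
  also have "\<dots> = (\<integral>\<^sup>+t. indicator {s..} t * emeasure M {\<omega> \<in> space M. t < b * X \<omega>} \<partial>lborel)"
    by (rule nn_integral_layer_cake) measurable
  also have "\<dots> \<le> (\<integral>\<^sup>+t. ennreal (K * b powr q) * (ennreal (t powr - q) * indicator {s..} t) \<partial>lborel)"
  proof (rule nn_integral_mono)
    fix t :: real
    have "measure M {\<omega> \<in> space M. t < b * X \<omega>} \<le> K * b powr q * t powr - q" if t: "s \<le> t"
    proof (cases "b = 0")
      case True
      then show ?thesis using t s by simp
    next
      case False
      then have "measure M {\<omega> \<in> space M. t < b * X \<omega>} = measure M {\<omega> \<in> space M. t / b < X \<omega>}"
        using b by (intro arg_cong[where f = "measure M"]) (auto simp: field_simps)
      also have "\<dots> \<le> K * (t / b) powr - q"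
        using False b s t by (intro tail) auto
      also have "\<dots> = K * b powr q * t powr - q"
        using False b s t by (simp add: powr_divide powr_minus field_simps)
      finally show ?thesis .
    qed
    then show "indicator {s..} t * emeasure M {\<omega> \<in> space M. t < b * X \<omega>} \<le>
          ennreal (K * b powr q) * (ennreal (t powr - q) * indicator {s..} t)"
      using K by (auto simp: emeasure_eq_measure ennreal_mult'[symmetric] mult.assoc intro!: ennreal_leI split: split_indicator)
  qed
  also have "\<dots> = ennreal (K * b powr q) * ennreal (s powr (1 - q) / (q - 1))"
    using q s by (subst nn_integral_cmult) (auto simp: nn_integral_powr_atLeast)
  also have "\<dots> = ennreal (K / (q - 1) * b powr q * s powr (1 - q))"
    using K q by (subst ennreal_mult[symmetric]) (auto simp: field_simps)
  finally show ?thesis .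
qed

text \<open>
  A maximum is at most a level \<open>s\<close> plus the sum of the excesses over \<open>s\<close>. Each excess has expectation at most
  a multiple of \<open>b\<^sub>j powr q * s powr (1 - q)\<close>, and with \<open>s\<close> equal to the \<open>\<ell>\<^sub>q\<close>-norm of \<open>b\<close> these add up to
  a multiple of \<open>s\<close> again.
\<close>

lemma (in prob_space) nn_integral_Max_le:
  fixes X :: "'i \<Rightarrow> 'a \<Rightarrow> real"
  assumes J: "finite J" "J \<noteq> {}"
    and X [measurable]: "\<And>j. j \<in> J \<Longrightarrow> X j \<in> borel_measurable M"
    and q: "1 < q" and K: "0 \<le> K" and b: "\<And>j. j \<in> J \<Longrightarrow> 0 \<le> b j"
    and tail: "\<And>j x. j \<in> J \<Longrightarrow> 0 < x \<Longrightarrow> measure M {\<omega> \<in> space M. x < X j \<omega>} \<le> K * x powr - q"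
  shows "(\<integral>\<^sup>+\<omega>. ennreal (Max ((\<lambda>j. b j * X j \<omega>) ` J)) \<partial>M)
    \<le> ennreal ((1 + K / (q - 1)) * (\<Sum>j\<in>J. b j powr q) powr (1 / q))"
proof (cases "(\<Sum>j\<in>J. b j powr q) = 0")
  case True
  then have "\<And>j. j \<in> J \<Longrightarrow> b j = 0"
    using J by (subst (asm) sum_nonneg_eq_0_iff) auto
  then have *: "(\<lambda>j. b j * X j \<omega>) ` J = {0}" for \<omega>
    using J by auto
  show ?thesis unfolding * by simp
next
  case False
  define S where "S = (\<Sum>j\<in>J. b j powr q)"
  define s where "s = S powr (1 / q)"
  have S: "0 < S" using False by (simp add: S_def order_less_le sum_nonneg)
  have s: "0 < s" using S by (simp add: s_def)
  have Ss: "S * s powr (1 - q) = s"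
    using S q by (simp add: s_def powr_powr powr_mult_base field_simps)
  have "(\<integral>\<^sup>+\<omega>. ennreal (Max ((\<lambda>j. b j * X j \<omega>) ` J)) \<partial>M)
    \<le> (\<integral>\<^sup>+\<omega>. ennreal s + (\<Sum>j\<in>J. ennreal (b j * X j \<omega> - s)) \<partial>M)"
  proof (rule nn_integral_mono)
    fix \<omega>
    have "Max ((\<lambda>j. b j * X j \<omega>) ` J) \<in> (\<lambda>j. b j * X j \<omega>) ` J"
      using J by (intro Max_in) auto
    then obtain j where j: "j \<in> J" "Max ((\<lambda>j. b j * X j \<omega>) ` J) = b j * X j \<omega>" by auto
    have "ennreal (b j * X j \<omega>) \<le> ennreal s + ennreal (b j * X j \<omega> - s)"
      using s by (cases "s \<le> b j * X j \<omega>") (auto simp: ennreal_plus[symmetric] ennreal_neg simp del: ennreal_plus intro!: ennreal_leI)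
    also have "\<dots> \<le> ennreal s + (\<Sum>j\<in>J. ennreal (b j * X j \<omega> - s))"
      using j J by (intro add_left_mono member_le_sum) auto
    finally show "ennreal (Max ((\<lambda>j. b j * X j \<omega>) ` J)) \<le> ennreal s + (\<Sum>j\<in>J. ennreal (b j * X j \<omega> - s))"
      using j by simp
  qed
  also have "\<dots> = ennreal s + (\<Sum>j\<in>J. \<integral>\<^sup>+\<omega>. ennreal (b j * X j \<omega> - s) \<partial>M)"
    using X by (subst nn_integral_add) (auto simp: nn_integral_sum emeasure_space_1)
  also have "\<dots> \<le> ennreal s + (\<Sum>j\<in>J. ennreal (K / (q - 1) * b j powr q * s powr (1 - q)))"
    using assms s by (intro add_left_mono sum_mono nn_integral_excess_le) auto
  also have "\<dots> = ennreal (s + K / (q - 1) * (S * s powr (1 - q)))"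
    using s K q
    by (subst sum_ennreal) (auto simp: S_def sum_distrib_left sum_distrib_right mult.assoc
        intro!: ennreal_plus[symmetric] sum_nonneg)
  also have "\<dots> = ennreal ((1 + K / (q - 1)) * s)"
    unfolding Ss by (simp add: algebra_simps)
  finally show ?thesis by (simp add: s_def S_def)
qed

text \<open>
  Let \<open>s\<close> be the \<open>\<ell>\<^sub>q\<close>-norm of \<open>b\<close>. Since \<open>b\<^sub>j \<le> s\<close>, the event \<open>b\<^sub>j X\<^sub>j > x0 * s\<close> only involves the tail of \<open>X\<^sub>j\<close>
  beyond \<open>x0\<close>, so it has probability at least \<open>k * x0 powr (- q) * (b\<^sub>j powr q / s powr q)\<close>. These numbers
  add up to \<open>k * x0 powr (- q)\<close>, and by independence and \<open>1 - u \<le> exp (- u)\<close> all events fail together with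
  probability at most \<open>exp (- k * x0 powr (- q))\<close>.
\<close>

lemma (in prob_space) nn_integral_Max_ge:
  fixes X :: "'i \<Rightarrow> 'a \<Rightarrow> real"
  assumes J: "finite J" "J \<noteq> {}"
    and indep: "indep_vars (\<lambda>_. borel) X J"
    and q: "0 < q" and k: "0 \<le> k" and x0: "0 < x0" and b: "\<And>j. j \<in> J \<Longrightarrow> 0 \<le> b j"
    and tail: "\<And>j x. j \<in> J \<Longrightarrow> x0 \<le> x \<Longrightarrow> k * x powr - q \<le> measure M {\<omega> \<in> space M. x < X j \<omega>}"
  shows "ennreal (x0 * (1 - exp (- k * x0 powr - q)) * (\<Sum>j\<in>J. b j powr q) powr (1 / q))
    \<le> (\<integral>\<^sup>+\<omega>. ennreal (Max ((\<lambda>j. b j * X j \<omega>) ` J)) \<partial>M)"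
proof (cases "(\<Sum>j\<in>J. b j powr q) = 0")
  case True
  then show ?thesis by simp
next
  case False
  define S where "S = (\<Sum>j\<in>J. b j powr q)"
  define s where "s = S powr (1 / q)"
  have X [measurable]: "\<And>j. j \<in> J \<Longrightarrow> X j \<in> borel_measurable M"
    using indep by (auto simp: indep_vars_def)
  have S: "0 < S" using False by (simp add: S_def order_less_le sum_nonneg)
  have s: "0 < s" using S by (simp add: s_def)
  have sq: "s powr q = S" using S q by (simp add: s_def powr_powr)
  have bs: "b j \<le> s" if "j \<in> J" for j
  proof -
    have "b j powr q \<le> S"
      unfolding S_def using J that by (intro member_le_sum) auto
    then have "(b j powr q) powr (1 / q) \<le> s"
      unfolding s_def using q by (intro powr_mono2) auto
    then show ?thesis using b[OF that] q by (simp add: powr_powr)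
  qed
  have one: "prob {\<omega> \<in> space M. b j * X j \<omega> \<le> x0 * s} \<le> exp (- (k * x0 powr - q * (b j powr q / S)))"
    if j: "j \<in> J" for j
  proof (cases "b j = 0")
    case True
    then show ?thesis by simp
  next
    case False
    then have b0: "0 < b j" using b[OF j] by simp
    have x: "x0 \<le> x0 * s / b j" using bs[OF j] b0 x0 by (simp add: field_simps)
    have "prob {\<omega> \<in> space M. b j * X j \<omega> \<le> x0 * s} = 1 - prob {\<omega> \<in> space M. x0 * s / b j < X j \<omega>}"
      using j b0 by (subst prob_compl[symmetric]) (auto intro!: arg_cong[where f = prob] simp: field_simps)
    also have "\<dots> \<le> 1 - k * (x0 * s / b j) powr - q"
      using tail[OF j x] by simp
    also have "(x0 * s / b j) powr - q = x0 powr - q * (b j powr q / S)"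
      using x0 s b0 by (simp add: powr_divide powr_mult powr_minus sq field_simps)
    also have "1 - k * \<dots> \<le> exp (- (k * x0 powr - q * (b j powr q / S)))"
      using exp_ge_add_one_self[of "- (k * x0 powr - q * (b j powr q / S))"] by (simp add: mult.assoc)
    finally show ?thesis .
  qed
  define A where "A = (\<Inter>j\<in>J. X j -` {x. b j * x \<le> x0 * s} \<inter> space M)"
  have A_alt: "A = {\<omega> \<in> space M. \<forall>j\<in>J. b j * X j \<omega> \<le> x0 * s}"
    using J by (auto simp: A_def)
  have A [measurable]: "A \<in> sets M"
    unfolding A_alt using J by measurable
  have "prob A = (\<Prod>j\<in>J. prob (X j -` {x. b j * x \<le> x0 * s} \<inter> space M))"
    unfolding A_def using J by (intro indep_varsD_finite[OF indep]) auto
  also have "\<dots> \<le> (\<Prod>j\<in>J. exp (- (k * x0 powr - q * (b j powr q / S))))"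
  proof (intro prod_mono conjI measure_nonneg)
    fix j assume "j \<in> J"
    moreover have "X j -` {x. b j * x \<le> x0 * s} \<inter> space M = {\<omega> \<in> space M. b j * X j \<omega> \<le> x0 * s}" by auto
    ultimately show "prob (X j -` {x. b j * x \<le> x0 * s} \<inter> space M) \<le> exp (- (k * x0 powr - q * (b j powr q / S)))"
      using one by simp
  qed
  also have "\<dots> = exp (- k * x0 powr - q)"
    using J S by (simp add: exp_sum[symmetric] sum_negf sum_distrib_left[symmetric]
      sum_divide_distrib[symmetric] S_def[symmetric])
  finally have PA: "1 - exp (- k * x0 powr - q) \<le> prob (space M - A)"
    by (subst prob_compl) auto
  have "ennreal (x0 * s * (1 - exp (- k * x0 powr - q))) \<le> ennreal (x0 * s * prob (space M - A))"
    using PA x0 s by (intro ennreal_leI mult_left_mono) auto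
  also have "\<dots> = (\<integral>\<^sup>+\<omega>. ennreal (x0 * s) * indicator (space M - A) \<omega> \<partial>M)"
    using x0 s by (subst nn_integral_cmult_indicator) (auto simp: emeasure_eq_measure ennreal_mult)
  also have "\<dots> \<le> (\<integral>\<^sup>+\<omega>. ennreal (Max ((\<lambda>j. b j * X j \<omega>) ` J)) \<partial>M)"
  proof (rule nn_integral_mono)
    fix \<omega> assume w: "\<omega> \<in> space M"
    show "ennreal (x0 * s) * indicator (space M - A) \<omega> \<le> ennreal (Max ((\<lambda>j. b j * X j \<omega>) ` J))"
    proof (cases "\<omega> \<in> A")
      case False
      then obtain j where "j \<in> J" "x0 * s < b j * X j \<omega>" using w by (auto simp: A_alt not_le)
      then have "x0 * s \<le> Max ((\<lambda>j. b j * X j \<omega>) ` J)"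
        using J by (subst Max_ge_iff) (auto intro!: bexI[of _ j])
      then show ?thesis by (auto split: split_indicator intro: ennreal_leI)
    qed simp
  qed
  finally show ?thesis
    by (simp add: s_def S_def mult_ac)
qed

section \<open>Tails of stable random variables\<close>

lemma (in prob_space) p_stable_nn_integral_cos:
  assumes "p_stable M p X"
  shows "(\<integral>\<^sup>+\<omega>. ennreal (1 - cos (t * X \<omega>)) \<partial>M) = ennreal (1 - exp (- (\<bar>t\<bar> powr p)))"
proof -
  have [measurable]: "X \<in> borel_measurable M"
    and char: "char (distr M borel X) t = complex_of_real (exp (- (\<bar>t\<bar> powr p)))"
    using assms by (auto simp: p_stable_def)
  have int: "integrable M (\<lambda>\<omega>. cos (t * X \<omega>))"
    by (rule integrable_const_bound[of _ 1]) auto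
  have inte: "integrable M (\<lambda>\<omega>. iexp (t * X \<omega>))"
    by (rule integrable_const_bound[of _ 1]) auto
  have "expectation (\<lambda>\<omega>. cos (t * X \<omega>)) = Re (CLINT \<omega>|M. iexp (t * X \<omega>))"
    using inte by (subst integral_Re[symmetric]) (auto simp: Re_exp)
  also have "(CLINT \<omega>|M. iexp (t * X \<omega>)) = char (distr M borel X) t"
    unfolding char_def by (subst integral_distr) auto
  finally have "expectation (\<lambda>\<omega>. cos (t * X \<omega>)) = exp (- (\<bar>t\<bar> powr p))"
    by (simp add: char)
  then have "expectation (\<lambda>\<omega>. 1 - cos (t * X \<omega>)) = 1 - exp (- (\<bar>t\<bar> powr p))"
    using int by (subst Bochner_Integration.integral_diff) (auto simp: prob_space)
  then show ?thesis
    using int by (subst nn_integral_eq_integral) auto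
qed

lemma nn_integral_one_minus_cos:
  fixes y :: real
  assumes "2 \<le> \<bar>y\<bar>"
  shows "ennreal (1 / 2) \<le> (\<integral>\<^sup>+t. ennreal (1 - cos (y * t)) * indicator {0..1} t \<partial>lborel)"
proof -
  have "y \<noteq> 0" using assms by auto
  then have "(\<integral>\<^sup>+t. ennreal (1 - cos (y * t)) * indicator {0..1} t \<partial>lborel) =
     ennreal ((1 - sin (y * 1) / y) - (0 - sin (y * 0) / y))"
    by (intro nn_integral_FTC_Icc) (auto intro!: derivative_eq_intros simp: has_real_derivative_iff_has_vector_derivative[symmetric])
  also have "\<dots> = ennreal (1 - sin y / y)" by simp
  also have "\<dots> \<ge> ennreal (1 / 2)"
  proof (rule ennreal_leI)
    have "\<bar>sin y / y\<bar> \<le> 1 / 2"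
    proof -
      have "\<bar>sin y\<bar> * 2 \<le> \<bar>y\<bar>" using abs_sin_le_one[of y] assms by linarith
      then show ?thesis using assms by (simp add: field_simps)
    qed
    then show "1 / 2 \<le> 1 - sin y / y" by linarith
  qed
  finally show ?thesis .
qed

text \<open>
  For \<open>u = 2 / x\<close>, averaging \<open>1 - cos (u t X)\<close> over \<open>t \<in> [0, 1]\<close> gives \<open>1 - sin (u X) / (u X)\<close>, which is at least
  \<open>1 / 2\<close> as soon as \<open>\<bar>X\<bar> > x\<close>. In expectation the integrand becomes \<open>1 - exp (- (\<bar>u t\<bar> powr p)) \<le> u powr p\<close>.
\<close>

lemma (in prob_space) p_stable_tail_le:
  assumes X: "p_stable M p X" and p: "0 < p" and x: "0 < x"
  shows "measure M {\<omega> \<in> space M. x < \<bar>X \<omega>\<bar>} \<le> 2 * 2 powr p * x powr - p"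
proof -
  have [measurable]: "X \<in> borel_measurable M" using X by (simp add: p_stable_def)
  interpret pair_sigma_finite M lborel ..
  let ?A = "{\<omega> \<in> space M. x < \<bar>X \<omega>\<bar>}"
  have "ennreal (1 / 2 * measure M ?A) = ennreal (1 / 2) * emeasure M ?A"
    unfolding emeasure_eq_measure by (rule ennreal_mult) auto
  also have "\<dots> = (\<integral>\<^sup>+\<omega>. ennreal (1 / 2) * indicator ?A \<omega> \<partial>M)"
    by (rule nn_integral_cmult_indicator[symmetric]) measurable
  also have "\<dots> \<le> (\<integral>\<^sup>+\<omega>. (\<integral>\<^sup>+t. ennreal (1 - cos (2 / x * X \<omega> * t)) * indicator {0..1} t \<partial>lborel) \<partial>M)"
  proof (rule nn_integral_mono)
    fix \<omega>
    show "ennreal (1 / 2) * indicator ?A \<omega> \<le>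
      (\<integral>\<^sup>+t. ennreal (1 - cos (2 / x * X \<omega> * t)) * indicator {0..1} t \<partial>lborel)"
      using nn_integral_one_minus_cos[of "2 / x * X \<omega>"] x
      by (auto simp: abs_mult field_simps split: split_indicator)
  qed
  also have "\<dots> = (\<integral>\<^sup>+t. (\<integral>\<^sup>+\<omega>. ennreal (1 - cos (2 / x * X \<omega> * t)) * indicator {0..1} t \<partial>M) \<partial>lborel)"
    by (rule Fubini'[symmetric]) measurable
  also have "\<dots> = (\<integral>\<^sup>+t. ennreal (1 - exp (- (\<bar>2 / x * t\<bar> powr p))) * indicator {0..1} t \<partial>lborel)"
    by (rule nn_integral_cong, subst nn_integral_multc, simp,
        subst p_stable_nn_integral_cos[OF X, symmetric]) (auto simp: mult_ac)
  also have "\<dots> \<le> (\<integral>\<^sup>+t. ennreal ((2 / x) powr p) * indicator {0..1::real} t \<partial>lborel)"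
  proof (rule nn_integral_mono)
    fix t :: real
    have "1 - exp (- (\<bar>2 / x * t\<bar> powr p)) \<le> (2 / x) powr p" if "0 \<le> t" "t \<le> 1"
    proof -
      have "1 - exp (- (\<bar>2 / x * t\<bar> powr p)) \<le> \<bar>2 / x * t\<bar> powr p"
        using exp_ge_add_one_self[of "- (\<bar>2 / x * t\<bar> powr p)"] by simp
      also have "\<dots> \<le> (2 / x) powr p"
        using that x p by (intro powr_mono2) (auto simp: field_simps)
      finally show ?thesis .
    qed
    then show "ennreal (1 - exp (- (\<bar>2 / x * t\<bar> powr p))) * indicator {0..1} t
        \<le> ennreal ((2 / x) powr p) * indicator {0..1} t"
      by (auto intro: ennreal_leI split: split_indicator)
  qed
  also have "\<dots> = ennreal ((2 / x) powr p)"
    by (subst nn_integral_cmult_indicator) auto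
  finally have "1 / 2 * measure M ?A \<le> (2 / x) powr p"
    by (subst (asm) ennreal_le_iff) auto
  then show ?thesis
    using x by (simp add: powr_divide powr_minus field_simps)
qed

text \<open>
  Exponents below \<open>2\<close> make the second moment infinite in general; truncated at \<open>R\<close> it grows only like
  \<open>R powr (2 - p)\<close>, by writing \<open>(min X R)\<^sup>2\<close> as the integral of \<open>2 t\<close> over \<open>t < X\<close>, \<open>t \<le> R\<close>.
\<close>

lemma (in prob_space) nn_integral_truncated_square_le:
  fixes X :: "'a \<Rightarrow> real"
  assumes [measurable]: "X \<in> borel_measurable M"
    and p: "p < 2" and K: "0 \<le> K" and R: "0 < R"
    and tail: "\<And>x. 0 < x \<Longrightarrow> measure M {\<omega> \<in> space M. x < X \<omega>} \<le> K * x powr - p"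
    and X0: "\<And>\<omega>. 0 \<le> X \<omega>"
  shows "(\<integral>\<^sup>+\<omega>. ennreal ((min (X \<omega>) R)\<^sup>2) \<partial>M) \<le> ennreal (2 * K / (2 - p) * R powr (2 - p))"
proof -
  have "(\<integral>\<^sup>+\<omega>. ennreal ((min (X \<omega>) R)\<^sup>2) \<partial>M) =
        (\<integral>\<^sup>+\<omega>. (\<integral>\<^sup>+t. (ennreal (2 * t) * indicator {0..R} t) * indicator {..<X \<omega>} t \<partial>lborel) \<partial>M)"
  proof (rule nn_integral_cong)
    fix \<omega>
    have "AE t in lborel. t \<noteq> X \<omega>" by (rule AE_lborel_singleton)
    then have "(\<integral>\<^sup>+t. (ennreal (2 * t) * indicator {0..R} t) * indicator {..<X \<omega>} t \<partial>lborel) =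
      (\<integral>\<^sup>+t. ennreal (2 * t) * indicator {0..min (X \<omega>) R} t \<partial>lborel)"
      by (intro nn_integral_cong_AE) (auto split: split_indicator)
    also have "\<dots> = ennreal ((min (X \<omega>) R)\<^sup>2 - 0\<^sup>2)"
      using X0[of \<omega>] R by (intro nn_integral_FTC_Icc)
        (auto intro!: derivative_eq_intros simp: has_real_derivative_iff_has_vector_derivative[symmetric])
    finally show "ennreal ((min (X \<omega>) R)\<^sup>2) =
      (\<integral>\<^sup>+t. (ennreal (2 * t) * indicator {0..R} t) * indicator {..<X \<omega>} t \<partial>lborel)" by simp
  qed
  also have "\<dots> = (\<integral>\<^sup>+t. ennreal (2 * t) * indicator {0..R} t * emeasure M {\<omega> \<in> space M. t < X \<omega>} \<partial>lborel)"
    by (rule nn_integral_layer_cake) measurable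
  also have "\<dots> \<le> (\<integral>\<^sup>+t. ennreal (2 * K) * (ennreal (t powr (1 - p)) * indicator {0..R} t) \<partial>lborel)"
  proof (rule nn_integral_mono)
    fix t :: real
    show "ennreal (2 * t) * indicator {0..R} t * emeasure M {\<omega> \<in> space M. t < X \<omega>} \<le>
       ennreal (2 * K) * (ennreal (t powr (1 - p)) * indicator {0..R} t)"
    proof (cases "0 < t \<and> t \<le> R")
      case True
      then have "2 * t * measure M {\<omega> \<in> space M. t < X \<omega>} \<le> 2 * t * (K * t powr - p)"
        using tail by (intro mult_left_mono) auto
      also have "\<dots> = 2 * K * t powr (1 - p)"
        using True by (simp add: powr_diff powr_minus field_simps)
      finally have "ennreal (2 * t * measure M {\<omega> \<in> space M. t < X \<omega>}) \<le> ennreal (2 * K * t powr (1 - p))"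
        by (rule ennreal_leI)
      then show ?thesis
        using True K by (simp add: emeasure_eq_measure ennreal_mult)
    qed (auto split: split_indicator)
  qed
  also have "\<dots> = ennreal (2 * K) * ennreal (R powr (2 - p) / (2 - p))"
  proof (subst nn_integral_cmult)
    have "((\<lambda>t. t powr (1 - p)) has_integral (R powr (1 - p + 1) / (1 - p + 1))) {0..R}"
      using p R by (intro has_integral_powr_from_0) auto
    then have "(\<integral>\<^sup>+t. ennreal (indicator {0..R} t * t powr (1 - p)) \<partial>lborel) = ennreal (R powr (1 - p + 1) / (1 - p + 1))"
      by (intro nn_integral_has_integral_lebesgue) auto
    also have "(\<integral>\<^sup>+t. ennreal (indicator {0..R} t * t powr (1 - p)) \<partial>lborel) =
        (\<integral>\<^sup>+t. ennreal (t powr (1 - p)) * indicator {0..R} t \<partial>lborel)"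
      by (rule nn_integral_cong) (auto split: split_indicator)
    finally show "ennreal (2 * K) * (\<integral>\<^sup>+t. ennreal (t powr (1 - p)) * indicator {0..R} t \<partial>lborel) =
         ennreal (2 * K) * ennreal (R powr (2 - p) / (2 - p))"
      by (simp add: algebra_simps)
  qed measurable
  also have "\<dots> = ennreal (2 * K / (2 - p) * R powr (2 - p))"
    using K p by (subst ennreal_mult[symmetric]) auto
  finally show ?thesis .
qed

lemma one_minus_exp_ge_half:
  fixes x :: real
  assumes "0 \<le> x" "x \<le> 1"
  shows "x / 2 \<le> 1 - exp (- x)"
proof -
  have "exp (- x) \<le> 1 / (1 + x)"
    using exp_ge_add_one_self[of x] assms by (simp add: exp_minus field_simps)
  moreover have "x / 2 \<le> 1 - 1 / (1 + x)"
    using assms by (simp add: field_simps mult_left_le)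
  ultimately show ?thesis by linarith
qed

lemma one_minus_cos_le: "1 - cos (x::real) \<le> x\<^sup>2 / 2"
proof -
  have "(sin (x / 2))\<^sup>2 \<le> (x / 2)\<^sup>2"
    using abs_sin_x_le_abs_x[of "x / 2"] by (simp only: abs_le_square_iff)
  then show ?thesis
    using cos_double_sin[of "x / 2"] by (simp add: power_divide)
qed

text \<open>
  Put \<open>t = d / x\<close> with a small \<open>d\<close>. Then \<open>E (1 - cos (t X)) \<ge> t powr p / 2\<close>, while \<open>1 - cos (t X)\<close> is at most \<open>2\<close> on
  \<open>\<bar>X\<bar> > x\<close> and at most \<open>(t * min \<bar>X\<bar> x)\<^sup>2 / 2\<close> elsewhere. By the upper tail bound the latter contributes
  at most a multiple of \<open>d powr (2 - p) * t powr p\<close>, which for small \<open>d\<close> is half of the total; the remainder must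
  come from \<open>P(\<bar>X\<bar> > x)\<close>. The constants are chosen before the variable, so that they depend on \<open>p\<close> only.
\<close>

lemma p_stable_tail_ge:
  fixes p :: real
  assumes p: "0 < p" "p < 2"
  obtains k x0 :: real where "0 < k" "0 < x0"
    "\<And>(M :: 'a measure) X x. prob_space M \<Longrightarrow> p_stable M p X \<Longrightarrow> x0 \<le> x \<Longrightarrow>
       k * x powr - p \<le> measure M {\<omega> \<in> space M. x < \<bar>X \<omega>\<bar>}"
proof -
  define K where "K = 2 * 2 powr p"
  \<comment> \<open>\<open>d\<close> makes the truncated part equal to \<open>t powr p / 4\<close>, as computed in \<open>dK\<close>.\<close>
  define d where "d = ((2 - p) / (4 * K)) powr (1 / (2 - p))"
  have K: "0 < K" by (simp add: K_def)
  have d: "0 < d" using p K by (simp add: d_def)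
  have dK: "K * d powr (2 - p) / (2 - p) = 1 / 4"
    using p K by (simp add: d_def powr_powr)
  show thesis
  proof (rule that)
    show "0 < d powr p / 8" "0 < d" using d by auto
  next
    fix M :: "'a measure" and X x
    assume "prob_space M" and X: "p_stable M p X" and x: "d \<le> x"
    interpret prob_space M by fact
    have [measurable]: "X \<in> borel_measurable M" using X by (simp add: p_stable_def)
    let ?A = "{\<omega> \<in> space M. x < \<bar>X \<omega>\<bar>}"
    define t where "t = d / x"
    have x0: "0 < x" using d x by simp
    have t: "0 < t" "t \<le> 1" using d x by (auto simp: t_def)
    have tp: "0 \<le> t powr p" "t powr p \<le> 1" using t p by (auto simp: powr_le1)
    have "ennreal (t powr p / 2) \<le> ennreal (1 - exp (- (\<bar>t\<bar> powr p)))"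
      using t tp one_minus_exp_ge_half by (intro ennreal_leI) auto
    also have "\<dots> = (\<integral>\<^sup>+\<omega>. ennreal (1 - cos (t * X \<omega>)) \<partial>M)"
      using p_stable_nn_integral_cos[OF X] by simp
    also have "\<dots> \<le> (\<integral>\<^sup>+\<omega>. 2 * indicator ?A \<omega> + ennreal (t\<^sup>2 / 2) * ennreal ((min \<bar>X \<omega>\<bar> x)\<^sup>2) \<partial>M)"
    proof (rule nn_integral_mono)
      fix \<omega> assume w: "\<omega> \<in> space M"
      show "ennreal (1 - cos (t * X \<omega>)) \<le> 2 * indicator ?A \<omega> + ennreal (t\<^sup>2 / 2) * ennreal ((min \<bar>X \<omega>\<bar> x)\<^sup>2)"
      proof (cases "x < \<bar>X \<omega>\<bar>")
        case True
        have "ennreal (1 - cos (t * X \<omega>)) \<le> ennreal 2"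
          using cos_ge_minus_one[of "t * X \<omega>"] by (intro ennreal_leI) linarith
        then show ?thesis using True w by (simp add: add_increasing2)
      next
        case False
        have "1 - cos (t * X \<omega>) \<le> t\<^sup>2 / 2 * (min \<bar>X \<omega>\<bar> x)\<^sup>2"
          using one_minus_cos_le[of "t * X \<omega>"] False by (simp add: power_mult_distrib)
        then have "ennreal (1 - cos (t * X \<omega>)) \<le> ennreal (t\<^sup>2 / 2 * (min \<bar>X \<omega>\<bar> x)\<^sup>2)"
          by (rule ennreal_leI)
        also have "\<dots> = ennreal (t\<^sup>2 / 2) * ennreal ((min \<bar>X \<omega>\<bar> x)\<^sup>2)"
          by (rule ennreal_mult) auto
        finally show ?thesis by (simp add: add_increasing)
      qed
    qed
    also have "\<dots> = ennreal (2 * prob ?A) + ennreal (t\<^sup>2 / 2) * (\<integral>\<^sup>+\<omega>. ennreal ((min \<bar>X \<omega>\<bar> x)\<^sup>2) \<partial>M)"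
      by (subst nn_integral_add, simp, simp, subst nn_integral_cmult_indicator, simp, subst nn_integral_cmult)
        (auto simp: emeasure_eq_measure ennreal_mult)
    also have "\<dots> \<le> ennreal (2 * prob ?A) + ennreal (t\<^sup>2 / 2) * ennreal (2 * K / (2 - p) * x powr (2 - p))"
      using p K x0 p_stable_tail_le[OF X \<open>0 < p\<close>]
      by (intro add_left_mono mult_left_mono nn_integral_truncated_square_le) (auto simp: K_def)
    also have "\<dots> = ennreal (2 * prob ?A + t\<^sup>2 / 2 * (2 * K / (2 - p) * x powr (2 - p)))"
      using K p by (simp add: ennreal_mult[symmetric] ennreal_plus[symmetric] del: ennreal_plus)
    also have "t\<^sup>2 / 2 * (2 * K / (2 - p) * x powr (2 - p)) = t powr p * (K * d powr (2 - p) / (2 - p))"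
    proof -
      have "t\<^sup>2 * x powr (2 - p) = t powr p * (t powr (2 - p) * x powr (2 - p))"
        using t by (simp add: powr_add[symmetric] powr_numeral mult.assoc[symmetric])
      also have "t powr (2 - p) * x powr (2 - p) = d powr (2 - p)"
        using t x0 by (subst powr_mult[symmetric]) (auto simp: t_def)
      finally show ?thesis using p by (simp add: field_simps)
    qed
    also have "\<dots> = t powr p / 4" unfolding dK by simp
    finally have "t powr p / 2 \<le> 2 * prob ?A + t powr p / 4"
      using tp by (subst (asm) ennreal_le_iff) auto
    then have "t powr p / 8 \<le> prob ?A" by simp
    moreover have "t powr p = d powr p * x powr - p"
      using d x0 by (simp add: t_def powr_divide powr_minus field_simps)
    ultimately show "d powr p / 8 * x powr - p \<le> prob ?A" by simp
  qed
qed

section \<open>Maxima of log-gamma random variables\<close>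

lemma (in prob_space) log_gamma_tail:
  assumes X: "log_gamma_distributed M 1 2 X" and x: "1 \<le> x"
  shows "measure M {\<omega> \<in> space M. x < \<bar>X \<omega>\<bar>} = x powr - 2"
proof -
  have D: "distributed M lborel X (\<lambda>x. ennreal (log_gamma_density 1 2 x))"
    using X by (simp add: log_gamma_distributed_def)
  have "X -` {t. x < \<bar>t\<bar>} \<inter> space M = {\<omega> \<in> space M. x < \<bar>X \<omega>\<bar>}" by auto
  then have "emeasure M {\<omega> \<in> space M. x < \<bar>X \<omega>\<bar>} =
      (\<integral>\<^sup>+t. ennreal (log_gamma_density 1 2 t) * indicator {t. x < \<bar>t\<bar>} t \<partial>lborel)"
    using distributed_emeasure[OF D, of "{t. x < \<bar>t\<bar>}"] by simp
  also have "\<dots> = (\<integral>\<^sup>+t. 2 * (ennreal (t powr - 3) * indicator {x..} t) \<partial>lborel)"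
  proof (rule nn_integral_cong_AE)
    \<comment> \<open>Besides the end point of the half-line this excludes, for \<open>x = 1\<close>, the point \<open>1\<close>, where the density
      takes the value \<open>0\<close> instead of \<open>2\<close>.\<close>
    have "AE t in lborel. t \<noteq> x" by (rule AE_lborel_singleton)
    then show "AE t in lborel. ennreal (log_gamma_density 1 2 t) * indicator {t. x < \<bar>t\<bar>} t =
        2 * (ennreal (t powr - 3) * indicator {x..} t)"
    proof eventually_elim
      case (elim t)
      show ?case
      proof (cases "1 < t")
        case True
        then show ?thesis using elim
          by (auto simp: log_gamma_density_1_2 ennreal_mult split: split_indicator)
      next
        case False
        then show ?thesis using elim x
          by (cases "t = 1") (auto simp: log_gamma_density_def split: split_indicator)
      qed
    qed
  qed
  also have "\<dots> = 2 * ennreal (x powr (1 - 3) / (3 - 1))"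
    using x by (subst nn_integral_cmult) (auto simp: nn_integral_powr_atLeast)
  also have "\<dots> = ennreal (2 * (x powr (1 - 3) / (3 - 1)))"
    by (subst ennreal_mult) auto
  finally show ?thesis by (simp add: emeasure_eq_measure)
qed

lemma (in prob_space) log_gamma_tail_le:
  assumes X: "log_gamma_distributed M 1 2 X" and x: "0 < x"
  shows "measure M {\<omega> \<in> space M. x < \<bar>X \<omega>\<bar>} \<le> x powr - 2"
proof (cases "1 \<le> x")
  case False
  then have "1 \<le> x powr - 2"
    using x ge_one_powr_ge_zero[of "1 / x" 2] by (simp add: powr_minus powr_divide field_simps)
  then show ?thesis using prob_le_1 order_trans by blast
qed (simp add: log_gamma_tail[OF X])

lemma log_gamma_measurable:
  "log_gamma_distributed M 1 2 X \<Longrightarrow> X \<in> borel_measurable M"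
  using distributed_measurable[of M lborel X] by (simp add: log_gamma_distributed_def)

text \<open>
  The \<open>p\<close>-th power of a maximum is the maximum of the \<open>p\<close>-th powers, and \<open>\<bar>X\<^sub>i\<bar> powr p\<close> has tail exponent
  \<open>2 / p > 1\<close>. The upper bound for maxima with this exponent, applied to the weights \<open>b\<^sub>i powr p\<close>, produces
  exactly the power \<open>p\<close> of the Euclidean norm.
\<close>

lemma (in prob_space) log_gamma_Max_powr_le:
  assumes I: "finite I" "I \<noteq> {}"
    and X: "\<And>i. i \<in> I \<Longrightarrow> log_gamma_distributed M 1 2 (X i)"
    and p: "0 < p" "p < 2" and b: "\<And>i. i \<in> I \<Longrightarrow> 0 \<le> b i"
  shows "(\<integral>\<^sup>+\<omega>. ennreal (Max ((\<lambda>i. b i * \<bar>X i \<omega>\<bar>) ` I) powr p) \<partial>M)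
     \<le> ennreal (2 / (2 - p) * (\<Sum>i\<in>I. b i powr 2) powr (p / 2))"
proof -
  have X_meas [measurable]: "\<And>i. i \<in> I \<Longrightarrow> X i \<in> borel_measurable M"
    using X log_gamma_measurable by blast
  have "(\<integral>\<^sup>+\<omega>. ennreal (Max ((\<lambda>i. b i * \<bar>X i \<omega>\<bar>) ` I) powr p) \<partial>M)
     \<le> (\<integral>\<^sup>+\<omega>. ennreal (Max ((\<lambda>i. b i powr p * \<bar>X i \<omega>\<bar> powr p) ` I)) \<partial>M)"
  proof (intro nn_integral_mono ennreal_leI)
    fix \<omega>
    have "Max ((\<lambda>i. b i * \<bar>X i \<omega>\<bar>) ` I) \<in> (\<lambda>i. b i * \<bar>X i \<omega>\<bar>) ` I"
      using I by (intro Max_in) auto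
    then obtain i where i: "i \<in> I" "Max ((\<lambda>i. b i * \<bar>X i \<omega>\<bar>) ` I) = b i * \<bar>X i \<omega>\<bar>" by auto
    then show "Max ((\<lambda>i. b i * \<bar>X i \<omega>\<bar>) ` I) powr p \<le> Max ((\<lambda>i. b i powr p * \<bar>X i \<omega>\<bar> powr p) ` I)"
      using I b by (subst Max_ge_iff) (auto simp: powr_mult)
  qed
  also have "\<dots> \<le> ennreal ((1 + 1 / (2 / p - 1)) * (\<Sum>i\<in>I. (b i powr p) powr (2 / p)) powr (1 / (2 / p)))"
  proof (rule nn_integral_Max_le[OF I])
    fix i and x :: real assume i: "i \<in> I" and x: "0 < x"
    have "{\<omega> \<in> space M. x < \<bar>X i \<omega>\<bar> powr p} = {\<omega> \<in> space M. x powr (1 / p) < \<bar>X i \<omega>\<bar>}"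
    proof (intro Collect_cong conj_cong refl)
      fix \<omega>
      have "x < \<bar>X i \<omega>\<bar> powr p \<longleftrightarrow> (x powr (1 / p)) powr p < \<bar>X i \<omega>\<bar> powr p"
        using x p by (simp add: powr_powr)
      also have "\<dots> \<longleftrightarrow> x powr (1 / p) < \<bar>X i \<omega>\<bar>"
        using p powr_less_mono2[of p "x powr (1 / p)" "\<bar>X i \<omega>\<bar>"]
          powr_mono2[of p "\<bar>X i \<omega>\<bar>" "x powr (1 / p)"]
        by (auto simp: not_le[symmetric])
      finally show "x < \<bar>X i \<omega>\<bar> powr p \<longleftrightarrow> x powr (1 / p) < \<bar>X i \<omega>\<bar>" .
    qed
    then have "prob {\<omega> \<in> space M. x < \<bar>X i \<omega>\<bar> powr p} \<le> (x powr (1 / p)) powr - 2"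
      using log_gamma_tail_le[OF X[OF i], of "x powr (1 / p)"] x by simp
    then show "prob {\<omega> \<in> space M. x < \<bar>X i \<omega>\<bar> powr p} \<le> 1 * x powr - (2 / p)"
      by (simp add: powr_powr)
  qed (use p in auto)
  also have "(\<Sum>i\<in>I. (b i powr p) powr (2 / p)) = (\<Sum>i\<in>I. b i powr 2)"
    using p by (simp add: powr_powr)
  also have "1 + 1 / (2 / p - 1) = 2 / (2 - p)"
    using p by (simp add: field_simps)
  finally show ?thesis by simp
qed

lemma (in prob_space) log_gamma_Max_ge:
  assumes I: "finite I" "I \<noteq> {}" and indep: "indep_vars (\<lambda>_. borel) X I"
    and X: "\<And>i. i \<in> I \<Longrightarrow> log_gamma_distributed M 1 2 (X i)"
    and b: "\<And>i. i \<in> I \<Longrightarrow> 0 \<le> b i"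
  shows "ennreal ((1 - exp (- 1)) * (\<Sum>i\<in>I. b i powr 2) powr (1 / 2))
     \<le> (\<integral>\<^sup>+\<omega>. ennreal (Max ((\<lambda>i. b i * \<bar>X i \<omega>\<bar>) ` I)) \<partial>M)"
proof -
  have "indep_vars (\<lambda>_. borel) (\<lambda>i \<omega>. \<bar>X i \<omega>\<bar>) I"
    by (rule indep_vars_compose2[OF indep]) auto
  from nn_integral_Max_ge[OF I this, of 2 1 1 b] show ?thesis
    using b X by (simp add: log_gamma_tail)
qed

section \<open>Elementary inequalities\<close>

text \<open>
  A replacement, with worse constants, for the tangent to the concave function \<open>y powr (1 / p)\<close> at \<open>s\<close>. Being
  affine in \<open>y\<close>, the right-hand side can be integrated term by term, which yields the effect of Jensen's
  inequality.
\<close>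

lemma powr_inverse_le_affine:
  fixes p s y :: real
  assumes "1 \<le> p" "0 < s" "0 \<le> y"
  shows "y powr (1 / p) \<le> s powr (1 / p) + s powr (1 / p - 1) * y"
proof (cases "y \<le> s")
  case True
  then have "y powr (1 / p) \<le> s powr (1 / p)" using assms by (intro powr_mono2) auto
  then show ?thesis using assms by (simp add: add_increasing2)
next
  case False
  then have "y powr (1 / p) = y powr (1 / p - 1) * y"
    using assms by (simp add: powr_mult_base mult.commute)
  also have "\<dots> \<le> s powr (1 / p - 1) * y"
    using False assms by (intro mult_right_mono powr_mono2') (auto simp: field_simps)
  finally show ?thesis using assms by (simp add: add_increasing)
qed

lemma mult_powr_le:
  fixes p x y :: real
  assumes "1 \<le> p" "0 \<le> x" "0 \<le> y"
  shows "x * y powr (p - 1) \<le> x powr p + y powr p"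
proof (cases "x \<le> y")
  case True
  then have "x * y powr (p - 1) \<le> y * y powr (p - 1)" by (intro mult_right_mono) auto
  also have "\<dots> = y powr p" using assms by (simp add: powr_mult_base)
  finally show ?thesis by (simp add: add_increasing)
next
  case False
  then have "x * y powr (p - 1) \<le> x * x powr (p - 1)"
    using assms by (intro mult_left_mono powr_mono2) auto
  also have "\<dots> = x powr p" using assms by (simp add: powr_mult_base)
  finally show ?thesis by (simp add: add_increasing2)
qed

text \<open>
  Hoelder's inequality with an extra factor \<open>2\<close>, in which the second vector already appears as a \<open>(p - 1)\<close>-st
  power. After normalising both vectors it is the sum of the pointwise bounds \<open>mult_powr_le\<close>.
\<close>

lemma sum_mult_powr_le:
  fixes p :: real and b \<beta> :: "'j \<Rightarrow> real"
  assumes p: "1 \<le> p" and J: "finite J"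
    and b: "\<And>j. j \<in> J \<Longrightarrow> 0 \<le> b j" and \<beta>: "\<And>j. j \<in> J \<Longrightarrow> 0 \<le> \<beta> j"
  shows "(\<Sum>j\<in>J. b j * \<beta> j powr (p - 1))
    \<le> 2 * (\<Sum>j\<in>J. b j powr p) powr (1 / p) * ((\<Sum>j\<in>J. \<beta> j powr p) powr (1 / p)) powr (p - 1)"
proof -
  define S where "S = (\<Sum>j\<in>J. b j powr p)"
  define T where "T = (\<Sum>j\<in>J. \<beta> j powr p)"
  define s where "s = S powr (1 / p)"
  define t where "t = T powr (1 / p)"
  have nonneg: "0 \<le> S" "0 \<le> T" by (auto simp: S_def T_def intro: sum_nonneg)
  have sp: "s powr p = S" "t powr p = T"
    using nonneg p by (auto simp: s_def t_def powr_powr)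
  show ?thesis
  proof (cases "S = 0 \<or> T = 0")
    case True
    then have "(\<forall>j\<in>J. b j = 0) \<or> (\<forall>j\<in>J. \<beta> j = 0)"
      using J by (auto simp: S_def T_def sum_nonneg_eq_0_iff)
    then have "(\<Sum>j\<in>J. b j * \<beta> j powr (p - 1)) = 0" by (auto intro!: sum.neutral)
    then show ?thesis by simp
  next
    case False
    then have ST: "0 < S" "0 < T" using nonneg by auto
    then have st: "0 < s" "0 < t" by (auto simp: s_def t_def)
    have "(\<Sum>j\<in>J. b j * \<beta> j powr (p - 1)) = s * t powr (p - 1) * (\<Sum>j\<in>J. b j / s * (\<beta> j / t) powr (p - 1))"
      unfolding sum_distrib_left using st \<beta> by (intro sum.cong) (auto simp: powr_divide)
    also have "(\<Sum>j\<in>J. b j / s * (\<beta> j / t) powr (p - 1)) \<le> (\<Sum>j\<in>J. (b j / s) powr p + (\<beta> j / t) powr p)"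
      using st b \<beta> p by (intro sum_mono mult_powr_le) auto
    also have "\<dots> = (\<Sum>j\<in>J. b j powr p / S + \<beta> j powr p / T)"
      using st b \<beta> by (intro sum.cong) (auto simp: powr_divide sp)
    also have "\<dots> = 2"
      using ST by (simp add: sum.distrib sum_divide_distrib[symmetric] S_def[symmetric] T_def[symmetric])
    finally show ?thesis
      using st by (simp add: s_def t_def S_def T_def mult_ac)
  qed
qed

lemma Max_image_Times:
  fixes f :: "'i \<Rightarrow> 'j \<Rightarrow> 'c::linorder"
  assumes I: "finite I" "I \<noteq> {}" and J: "finite J" "J \<noteq> {}"
  shows "Max ((\<lambda>(i, j). f i j) ` (I \<times> J)) = Max ((\<lambda>j. Max ((\<lambda>i. f i j) ` I)) ` J)"
proof (rule antisym)
  show "Max ((\<lambda>(i, j). f i j) ` (I \<times> J)) \<le> Max ((\<lambda>j. Max ((\<lambda>i. f i j) ` I)) ` J)"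
    using assms by (subst Max_le_iff) (auto simp: Max_ge_iff)
  show "Max ((\<lambda>j. Max ((\<lambda>i. f i j) ` I)) ` J) \<le> Max ((\<lambda>(i, j). f i j) ` (I \<times> J))"
    using assms by (subst Max_le_iff) (auto intro!: Max_ge)
qed

lemma Max_mult_right:
  fixes f :: "'i \<Rightarrow> real"
  assumes "finite I" "I \<noteq> {}" "0 \<le> y"
  shows "Max ((\<lambda>i. f i * y) ` I) = Max (f ` I) * y"
proof -
  have "mono (\<lambda>x. x * y)" using assms by (auto intro!: monoI mult_right_mono)
  from mono_Max_commute[OF this, of "f ` I"] show ?thesis
    using assms by (simp add: image_image)
qed

text \<open>
  For fixed \<open>x\<close> the maximum over the matrix is a maximum over \<open>j\<close> alone, with nonnegative weights
  that depend on \<open>x\<close>.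
\<close>

lemma Max_matrix_eq:
  fixes a :: "'i \<Rightarrow> 'j \<Rightarrow> real"
  assumes I: "finite I" "I \<noteq> {}" and J: "finite J" "J \<noteq> {}"
  shows "Max ((\<lambda>(i, j). \<bar>a i j * y j * x i\<bar>) ` (I \<times> J)) =
    Max ((\<lambda>j. Max ((\<lambda>i. \<bar>a i j\<bar> * \<bar>x i\<bar>) ` I) * \<bar>y j\<bar>) ` J)"
proof -
  have "Max ((\<lambda>(i, j). \<bar>a i j * y j * x i\<bar>) ` (I \<times> J)) =
      Max ((\<lambda>j. Max ((\<lambda>i. \<bar>a i j * y j * x i\<bar>) ` I)) ` J)"
    using assms by (rule Max_image_Times)
  also have "\<dots> = Max ((\<lambda>j. Max ((\<lambda>i. (\<bar>a i j\<bar> * \<bar>x i\<bar>) * \<bar>y j\<bar>) ` I)) ` J)"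
    by (simp add: abs_mult mult_ac)
  also have "\<dots> = Max ((\<lambda>j. Max ((\<lambda>i. \<bar>a i j\<bar> * \<bar>x i\<bar>) ` I) * \<bar>y j\<bar>) ` J)"
    using I by (subst Max_mult_right) auto
  finally show ?thesis .
qed

section \<open>The iterated expectation\<close>

lemma (in prob_space) p_stable_Max_le:
  assumes J: "finite J" "J \<noteq> {}" and X: "\<And>j. j \<in> J \<Longrightarrow> p_stable M p (X j)"
    and p: "1 < p" and b: "\<And>j. j \<in> J \<Longrightarrow> 0 \<le> b j"
  shows "(\<integral>\<^sup>+\<omega>. ennreal (Max ((\<lambda>j. b j * \<bar>X j \<omega>\<bar>) ` J)) \<partial>M)
        \<le> ennreal ((1 + 2 * 2 powr p / (p - 1)) * (\<Sum>j\<in>J. b j powr p) powr (1 / p))"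
proof (rule nn_integral_Max_le[OF J])
  show "(\<lambda>\<omega>. \<bar>X j \<omega>\<bar>) \<in> borel_measurable M" if "j \<in> J" for j
    using X[OF that] by (auto simp: p_stable_def)
  show "prob {\<omega> \<in> space M. x < \<bar>X j \<omega>\<bar>} \<le> 2 * 2 powr p * x powr - p" if "j \<in> J" "0 < x" for j x
    using p_stable_tail_le[OF X[OF that(1)]] that p by simp
qed (use p b in auto)

text \<open>
  With \<open>S\<close> the \<open>p\<close>-th power of the mixed norm, \<open>powr_inverse_le_affine\<close> at \<open>S\<close> reduces the claim to a bound
  by a multiple of \<open>S\<close> for the expected sum of the \<open>p\<close>-th powers of the column maxima. That sum is
  treated column by column.
\<close>

lemma (in prob_space) log_gamma_mixed_norm_le:
  fixes a :: "'i \<Rightarrow> 'j \<Rightarrow> real"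
  assumes I: "finite I" "I \<noteq> {}" and J: "finite J"
    and X: "\<And>i. i \<in> I \<Longrightarrow> log_gamma_distributed M 1 2 (X i)"
    and p: "1 \<le> p" "p < 2"
  shows "(\<integral>\<^sup>+\<omega>. ennreal ((\<Sum>j\<in>J. Max ((\<lambda>i. \<bar>a i j\<bar> * \<bar>X i \<omega>\<bar>) ` I) powr p) powr (1 / p)) \<partial>M)
    \<le> ennreal ((1 + 2 / (2 - p)) * (\<Sum>j\<in>J. (\<Sum>i\<in>I. \<bar>a i j\<bar> powr 2) powr (p / 2)) powr (1 / p))"
proof -
  define B where "B \<omega> j = Max ((\<lambda>i. \<bar>a i j\<bar> * \<bar>X i \<omega>\<bar>) ` I)" for \<omega> j
  define S where "S = (\<Sum>j\<in>J. (\<Sum>i\<in>I. \<bar>a i j\<bar> powr 2) powr (p / 2))"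
  have X_meas [measurable]: "\<And>i. i \<in> I \<Longrightarrow> X i \<in> borel_measurable M"
    using X log_gamma_measurable by blast
  have B_meas [measurable]: "(\<lambda>\<omega>. B \<omega> j) \<in> borel_measurable M" for j
    unfolding B_def using I by measurable
  show ?thesis
  proof (cases "S = 0")
    case True
    have "a i j = 0" if "i \<in> I" "j \<in> J" for i j
      using True that I J by (simp add: S_def sum_nonneg_eq_0_iff sum_nonneg)
    then have "(\<lambda>i. \<bar>a i j\<bar> * \<bar>X i \<omega>\<bar>) ` I = {0}" if "j \<in> J" for j \<omega>
      using I that by auto
    then show ?thesis by simp
  next
    case False
    then have S: "0 < S" by (simp add: S_def order_less_le sum_nonneg)
    have "(\<integral>\<^sup>+\<omega>. ennreal ((\<Sum>j\<in>J. B \<omega> j powr p) powr (1 / p)) \<partial>M)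
      \<le> (\<integral>\<^sup>+\<omega>. ennreal (S powr (1 / p)) + ennreal (S powr (1 / p - 1)) * (\<Sum>j\<in>J. ennreal (B \<omega> j powr p)) \<partial>M)"
    proof (rule nn_integral_mono)
      fix \<omega>
      have "ennreal ((\<Sum>j\<in>J. B \<omega> j powr p) powr (1 / p))
        \<le> ennreal (S powr (1 / p) + S powr (1 / p - 1) * (\<Sum>j\<in>J. B \<omega> j powr p))"
        using p S by (intro ennreal_leI powr_inverse_le_affine sum_nonneg) auto
      also have "\<dots> = ennreal (S powr (1 / p)) + ennreal (S powr (1 / p - 1)) * (\<Sum>j\<in>J. ennreal (B \<omega> j powr p))"
        by (simp add: ennreal_mult sum_nonneg)
      finally show "ennreal ((\<Sum>j\<in>J. B \<omega> j powr p) powr (1 / p))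
        \<le> ennreal (S powr (1 / p)) + ennreal (S powr (1 / p - 1)) * (\<Sum>j\<in>J. ennreal (B \<omega> j powr p))" .
    qed
    also have "\<dots> = ennreal (S powr (1 / p)) + ennreal (S powr (1 / p - 1)) * (\<Sum>j\<in>J. \<integral>\<^sup>+\<omega>. ennreal (B \<omega> j powr p) \<partial>M)"
      by (simp add: nn_integral_add nn_integral_cmult nn_integral_sum emeasure_space_1 del: sum_ennreal)
    also have "\<dots> \<le> ennreal (S powr (1 / p)) + ennreal (S powr (1 / p - 1)) *
        (\<Sum>j\<in>J. ennreal (2 / (2 - p) * (\<Sum>i\<in>I. \<bar>a i j\<bar> powr 2) powr (p / 2)))"
      unfolding B_def using p I X
      by (intro add_left_mono mult_left_mono sum_mono log_gamma_Max_powr_le) auto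
    also have "(\<Sum>j\<in>J. ennreal (2 / (2 - p) * (\<Sum>i\<in>I. \<bar>a i j\<bar> powr 2) powr (p / 2))) = ennreal (2 / (2 - p) * S)"
      unfolding S_def sum_distrib_left using p by (intro sum_ennreal) auto
    also have "ennreal (S powr (1 / p)) + ennreal (S powr (1 / p - 1)) * ennreal (2 / (2 - p) * S) =
        ennreal (S powr (1 / p) + S powr (1 / p - 1) * (2 / (2 - p) * S))"
      using p S by (simp add: ennreal_mult[symmetric] ennreal_plus[symmetric] del: ennreal_plus)
    also have "S powr (1 / p - 1) * (2 / (2 - p) * S) = 2 / (2 - p) * S powr (1 / p)"
      using S by (simp add: powr_mult_base mult_ac)
    also have "S powr (1 / p) + 2 / (2 - p) * S powr (1 / p) = (1 + 2 / (2 - p)) * S powr (1 / p)"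
      by (simp only: distrib_right mult_1)
    finally show ?thesis by (simp add: B_def S_def)
  qed
qed

text \<open>
  The \<open>\<ell>\<^sub>p\<close>-norm of the column maxima \<open>B\<close> dominates the linear functional \<open>\<Sum>\<^sub>j w\<^sub>j B\<^sub>j\<close>, where \<open>w\<close> is half of the
  functional that norms the vector \<open>\<beta>\<close> of Euclidean column norms; the half absorbs the factor \<open>2\<close> of
  \<open>sum_mult_powr_le\<close>. Expectations pass through this functional, and it takes the value \<open>N / 2\<close> at \<open>\<beta>\<close>,
  for \<open>N\<close> the \<open>\<ell>\<^sub>p\<close>-norm of \<open>\<beta>\<close>.
\<close>

lemma (in prob_space) log_gamma_mixed_norm_ge:
  fixes a :: "'i \<Rightarrow> 'j \<Rightarrow> real"
  assumes I: "finite I" "I \<noteq> {}" and J: "finite J"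
    and indep: "indep_vars (\<lambda>_. borel) X I"
    and X: "\<And>i. i \<in> I \<Longrightarrow> log_gamma_distributed M 1 2 (X i)"
    and p: "1 \<le> p"
  shows "ennreal ((1 - exp (- 1)) / 2 * (\<Sum>j\<in>J. (\<Sum>i\<in>I. \<bar>a i j\<bar> powr 2) powr (p / 2)) powr (1 / p)) \<le>
    (\<integral>\<^sup>+\<omega>. ennreal ((\<Sum>j\<in>J. Max ((\<lambda>i. \<bar>a i j\<bar> * \<bar>X i \<omega>\<bar>) ` I) powr p) powr (1 / p)) \<partial>M)"
proof -
  define B where "B \<omega> j = Max ((\<lambda>i. \<bar>a i j\<bar> * \<bar>X i \<omega>\<bar>) ` I)" for \<omega> j
  define \<beta> where "\<beta> j = (\<Sum>i\<in>I. \<bar>a i j\<bar> powr 2) powr (1 / 2)" for j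
  define T where "T = (\<Sum>j\<in>J. \<beta> j powr p)"
  define N where "N = T powr (1 / p)"
  have \<beta>p: "(\<Sum>i\<in>I. \<bar>a i j\<bar> powr 2) powr (p / 2) = \<beta> j powr p" for j
    using p by (simp add: \<beta>_def powr_powr)
  have \<beta>0: "0 \<le> \<beta> j" for j by (simp add: \<beta>_def)
  have B0: "0 \<le> B \<omega> j" for \<omega> j
    unfolding B_def using I by (subst Max_ge_iff) auto
  have X_meas [measurable]: "\<And>i. i \<in> I \<Longrightarrow> X i \<in> borel_measurable M"
    using X log_gamma_measurable by blast
  have B_meas [measurable]: "(\<lambda>\<omega>. B \<omega> j) \<in> borel_measurable M" for j
    unfolding B_def using I by measurable
  show ?thesis
  proof (cases "T = 0")
    case True
    then show ?thesis by (simp only: \<beta>p T_def[symmetric]) simp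
  next
    case False
    then have T: "0 < T" by (simp add: T_def order_less_le sum_nonneg)
    then have N: "0 < N" by (simp add: N_def)
    have Np: "N powr p = T" using T p by (simp add: N_def powr_powr)
    define w where "w j = (\<beta> j / N) powr (p - 1) / 2" for j
    have w0: "0 \<le> w j" for j by (simp add: w_def)
    have \<beta>w: "(\<Sum>j\<in>J. w j * \<beta> j) = N / 2"
    proof -
      have "w j * \<beta> j = \<beta> j powr p * (1 / (2 * N powr (p - 1)))" for j
        using \<beta>0[of j] N powr_mult_base[of "\<beta> j" "p - 1"] by (simp add: w_def powr_divide mult_ac)
      then have "(\<Sum>j\<in>J. w j * \<beta> j) = N powr p * (1 / (2 * N powr (p - 1)))"
        by (simp only: sum_distrib_right[symmetric] T_def Np)
      also have "\<dots> = N / 2" using N by (simp add: powr_diff)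
      finally show ?thesis .
    qed
    have dual: "(\<Sum>j\<in>J. w j * B \<omega> j) \<le> (\<Sum>j\<in>J. B \<omega> j powr p) powr (1 / p)" for \<omega>
    proof -
      have "(\<Sum>j\<in>J. w j * B \<omega> j) = (\<Sum>j\<in>J. B \<omega> j * \<beta> j powr (p - 1)) / (2 * N powr (p - 1))"
        unfolding sum_divide_distrib using N \<beta>0 by (intro sum.cong) (auto simp: w_def powr_divide mult_ac)
      also have "\<dots> \<le> (2 * (\<Sum>j\<in>J. B \<omega> j powr p) powr (1 / p) * N powr (p - 1)) / (2 * N powr (p - 1))"
        unfolding N_def T_def using p J B0 \<beta>0 by (intro divide_right_mono sum_mult_powr_le) auto
      also have "\<dots> = (\<Sum>j\<in>J. B \<omega> j powr p) powr (1 / p)" using N by simp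
      finally show ?thesis .
    qed
    have "ennreal ((1 - exp (- 1)) / 2 * N) = ennreal ((1 - exp (- 1)) * (\<Sum>j\<in>J. w j * \<beta> j))"
      by (simp add: \<beta>w)
    also have "\<dots> = (\<Sum>j\<in>J. ennreal (w j) * ennreal ((1 - exp (- 1)) * \<beta> j))"
      using w0 \<beta>0 by (simp add: sum_distrib_left ennreal_mult[symmetric] mult_ac)
    also have "\<dots> \<le> (\<Sum>j\<in>J. ennreal (w j) * (\<integral>\<^sup>+\<omega>. ennreal (B \<omega> j) \<partial>M))"
      unfolding B_def \<beta>_def using I indep X
      by (intro sum_mono mult_left_mono log_gamma_Max_ge) auto
    also have "\<dots> = (\<integral>\<^sup>+\<omega>. (\<Sum>j\<in>J. ennreal (w j) * ennreal (B \<omega> j)) \<partial>M)"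
      by (simp add: nn_integral_sum nn_integral_cmult)
    also have "\<dots> = (\<integral>\<^sup>+\<omega>. ennreal (\<Sum>j\<in>J. w j * B \<omega> j) \<partial>M)"
      using w0 B0 by (simp add: ennreal_mult[symmetric])
    also have "\<dots> \<le> (\<integral>\<^sup>+\<omega>. ennreal ((\<Sum>j\<in>J. B \<omega> j powr p) powr (1 / p)) \<partial>M)"
      by (intro nn_integral_mono ennreal_leI dual)
    finally show ?thesis by (simp only: \<beta>p N_def T_def B_def)
  qed
qed

lemma max_estimate_exists:
  fixes p :: real
  assumes p: "1 < p" "p < 2"
  shows "\<exists>c>0. \<exists>C>0. max_estimate TYPE('a) TYPE('b) p c C"
proof -
  obtain k x0 :: real where k: "0 < k" and x0: "0 < x0" and tail:
    "\<And>(M :: 'b measure) X x. prob_space M \<Longrightarrow> p_stable M p X \<Longrightarrow> x0 \<le> x \<Longrightarrow>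
       k * x powr - p \<le> measure M {\<omega> \<in> space M. x < \<bar>X \<omega>\<bar>}"
    using p_stable_tail_ge[of p, where 'a = 'b] p by auto
  define c where "c = x0 * (1 - exp (- k * x0 powr - p))"
  define C where "C = 1 + 2 * 2 powr p / (p - 1)"
  have c: "0 < c" using k x0 by (simp add: c_def)
  have C: "0 < C" using p by (simp add: C_def add_pos_pos)
  define c' where "c' = c * ((1 - exp (- 1)) / 2)"
  define C' where "C' = C * (1 + 2 / (2 - p))"
  have "max_estimate TYPE('a) TYPE('b) p c' C'"
    unfolding max_estimate_def
  proof (intro allI impI)
    fix n m :: nat and M1 :: "'a measure" and M2 :: "'b measure"
      and \<xi> :: "nat \<Rightarrow> 'a \<Rightarrow> real" and \<eta> :: "nat \<Rightarrow> 'b \<Rightarrow> real" and a :: "nat \<Rightarrow> nat \<Rightarrow> real"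
    assume n: "1 \<le> n" and m: "1 \<le> m" and M1: "prob_space M1" and M2: "prob_space M2"
      and indep1: "prob_space.indep_vars M1 (\<lambda>_. borel) \<xi> {1..n}"
      and \<xi>: "\<forall>i\<in>{1..n}. log_gamma_distributed M1 1 2 (\<xi> i)"
      and indep2: "prob_space.indep_vars M2 (\<lambda>_. borel) \<eta> {1..m}"
      and \<eta>: "\<forall>j\<in>{1..m}. p_stable M2 p (\<eta> j)"
    interpret M1: prob_space M1 by fact
    interpret M2: prob_space M2 by fact
    have I: "finite {1..n}" "{1..n} \<noteq> {}" and J: "finite {1..m}" "{1..m} \<noteq> {}" using n m by auto
    define N where "N = (\<Sum>j=1..m. (\<Sum>i=1..n. \<bar>a i j\<bar>\<^sup>2) powr (p / 2)) powr (1 / p)"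
    define B where "B \<omega> j = Max ((\<lambda>i. \<bar>a i j\<bar> * \<bar>\<xi> i \<omega>\<bar>) ` {1..n})" for \<omega> j
    define F where "F \<omega> = (\<Sum>j=1..m. B \<omega> j powr p) powr (1 / p)" for \<omega>
    define E2 where "E2 \<omega>1 = (\<integral>\<^sup>+ \<omega>2. ennreal (Max ((\<lambda>(i, j). \<bar>a i j * \<eta> j \<omega>2 * \<xi> i \<omega>1\<bar>) ` ({1..n} \<times> {1..m}))) \<partial>M2)" for \<omega>1
    have N_alt: "N = (\<Sum>j\<in>{1..m}. (\<Sum>i\<in>{1..n}. \<bar>a i j\<bar> powr 2) powr (p / 2)) powr (1 / p)"
      by (simp add: N_def powr_numeral)
    have B0: "0 \<le> B \<omega> j" for \<omega> j
      unfolding B_def using I by (subst Max_ge_iff) auto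
    have \<xi>_meas [measurable]: "\<xi> i \<in> borel_measurable M1" if "i \<in> {1..n}" for i
      using \<xi> that log_gamma_measurable by blast
    have \<xi>_meas [measurable]: "\<xi> i \<in> borel_measurable M1" if "i \<in> {1..n}" for i
      using \<xi> that log_gamma_measurable by blast
    have B_meas [measurable]: "(\<lambda>\<omega>. B \<omega> j) \<in> borel_measurable M1" for j
      unfolding B_def using I by measurable
    have F_meas [measurable]: "F \<in> borel_measurable M1"
      unfolding F_def by measurable
    have E2_eq: "E2 \<omega> = (\<integral>\<^sup>+ \<omega>2. ennreal (Max ((\<lambda>j. B \<omega> j * \<bar>\<eta> j \<omega>2\<bar>) ` {1..m})) \<partial>M2)" for \<omega>
      unfolding E2_def Max_matrix_eq[OF I J] B_def ..
    have indep2': "M2.indep_vars (\<lambda>_. borel) (\<lambda>j \<omega>. \<bar>\<eta> j \<omega>\<bar>) {1..m}"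
      by (rule M2.indep_vars_compose2[OF indep2]) auto
    have E2_ge: "ennreal (c * F \<omega>) \<le> E2 \<omega>" for \<omega>
      unfolding E2_eq F_def c_def using J indep2' p k x0 B0 tail[OF M2] \<eta>
      by (intro M2.nn_integral_Max_ge) auto
    have E2_le: "E2 \<omega> \<le> ennreal (C * F \<omega>)" for \<omega>
      unfolding E2_eq F_def C_def using J \<eta> p B0 by (intro M2.p_stable_Max_le) auto
    have "ennreal (c' * N) = ennreal c * ennreal ((1 - exp (- 1)) / 2 * N)"
      using c by (simp add: c'_def N_def ennreal_mult[symmetric] mult_ac)
    also have "\<dots> \<le> ennreal c * (\<integral>\<^sup>+\<omega>. ennreal (F \<omega>) \<partial>M1)"
      unfolding N_alt F_def B_def using I J indep1 \<xi> p
      by (intro mult_left_mono M1.log_gamma_mixed_norm_ge) auto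
    also have "\<dots> = (\<integral>\<^sup>+\<omega>. ennreal (c * F \<omega>) \<partial>M1)"
      using c by (simp add: nn_integral_cmult[symmetric] ennreal_mult F_def)
    also have "\<dots> \<le> (\<integral>\<^sup>+\<omega>. E2 \<omega> \<partial>M1)"
      by (intro nn_integral_mono E2_ge)
    finally have lower: "ennreal (c' * N) \<le> (\<integral>\<^sup>+\<omega>. E2 \<omega> \<partial>M1)" .
    have "(\<integral>\<^sup>+\<omega>. E2 \<omega> \<partial>M1) \<le> (\<integral>\<^sup>+\<omega>. ennreal (C * F \<omega>) \<partial>M1)"
      by (intro nn_integral_mono E2_le)
    also have "\<dots> = ennreal C * (\<integral>\<^sup>+\<omega>. ennreal (F \<omega>) \<partial>M1)"
      using C by (simp add: nn_integral_cmult[symmetric] ennreal_mult F_def)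
    also have "\<dots> \<le> ennreal C * ennreal ((1 + 2 / (2 - p)) * N)"
      unfolding N_alt F_def B_def using I J \<xi> p
      by (intro mult_left_mono M1.log_gamma_mixed_norm_le) auto
    also have "\<dots> = ennreal (C' * N)"
      using C p by (simp add: C'_def N_def ennreal_mult[symmetric] mult_ac)
    finally have upper: "(\<integral>\<^sup>+\<omega>. E2 \<omega> \<partial>M1) \<le> ennreal (C' * N)" .
    show "let N = (\<Sum>j=1..m. (\<Sum>i=1..n. \<bar>a i j\<bar>\<^sup>2) powr (p / 2)) powr (1 / p);
             E = (\<integral>\<^sup>+ \<omega>1. (\<integral>\<^sup>+ \<omega>2.
                    ennreal (Max ((\<lambda>(i, j). \<bar>a i j * \<eta> j \<omega>2 * \<xi> i \<omega>1\<bar>) ` ({1..n} \<times> {1..m})))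
                    \<partial>M2) \<partial>M1)
         in ennreal (c' * N) \<le> E \<and> E \<le> ennreal (C' * N)"
      using lower upper unfolding Let_def N_def E2_def by simp
  qed
  moreover have "0 < c'" using c by (simp add: c'_def)
  moreover have "0 < C'" using C p by (simp add: C'_def add_pos_pos)
  ultimately show ?thesis by blast
qed

section \<open>Independence of the sample types\<close>

text \<open>
  On the joint law of the family \<open>X\<close>, the coordinate functions are a copy of \<open>X\<close>: they are independent and have the
  same marginals.
\<close>

lemma (in prob_space) joint_law_coordinates:
  fixes X :: "'i \<Rightarrow> 'a \<Rightarrow> real"
  assumes indep: "indep_vars (\<lambda>_. borel) X I" and I: "I \<noteq> {}"
  defines "D \<equiv> distr M (\<Pi>\<^sub>M i\<in>I. borel) (\<lambda>\<omega>. \<lambda>i\<in>I. X i \<omega>)"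
  shows "prob_space D"
    and "\<And>i. i \<in> I \<Longrightarrow> distr D borel (\<lambda>x. x i) = distr M borel (X i)"
    and "prob_space.indep_vars D (\<lambda>_. borel) (\<lambda>i x. x i) I"
proof -
  have X [measurable]: "\<And>i. i \<in> I \<Longrightarrow> X i \<in> borel_measurable M"
    using indep by (auto simp: indep_vars_def)
  show D: "prob_space D"
    unfolding D_def by (rule prob_space_distr) measurable
  interpret D: prob_space D by (rule D)
  show coord: "distr D borel (\<lambda>x. x i) = distr M borel (X i)" if "i \<in> I" for i
    unfolding D_def using that
    by (subst distr_distr) (auto intro!: distr_cong simp: comp_def)
  have [simp]: "sets D = sets (\<Pi>\<^sub>M i\<in>I. borel)" "space D = space (\<Pi>\<^sub>M i\<in>I. borel)"
    by (simp_all add: D_def)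
  have "distr D (\<Pi>\<^sub>M i\<in>I. borel) (\<lambda>x. \<lambda>i\<in>I. x i) = distr D D (\<lambda>x. x)"
    by (rule distr_cong) (auto simp: space_PiM PiE_def extensional_restrict)
  also have "\<dots> = D" by simp
  also have "\<dots> = (\<Pi>\<^sub>M i\<in>I. distr M borel (X i))"
    unfolding D_def using indep X by (subst (asm) indep_vars_iff_distr_eq_PiM'[OF I]) auto
  also have "\<dots> = (\<Pi>\<^sub>M i\<in>I. distr D borel (\<lambda>x. x i))"
    by (intro PiM_cong) (auto simp: coord)
  finally show "prob_space.indep_vars D (\<lambda>_. borel) (\<lambda>i x. x i) I"
    by (subst D.indep_vars_iff_distr_eq_PiM'[OF I]) (auto simp: D_def)
qed

text \<open>
  Replacing both families by the coordinates on their joint laws changes neither the hypotheses nor, by the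
  change of variables formula, the iterated integral.
\<close>

lemma max_estimate_transfer:
  assumes est: "max_estimate TYPE(nat \<Rightarrow> real) TYPE(nat \<Rightarrow> real) p c C"
  shows "max_estimate TYPE('a) TYPE('b) p c C"
  unfolding max_estimate_def
proof (intro allI impI)
  fix n m :: nat and M1 :: "'a measure" and M2 :: "'b measure"
    and \<xi> :: "nat \<Rightarrow> 'a \<Rightarrow> real" and \<eta> :: "nat \<Rightarrow> 'b \<Rightarrow> real" and a :: "nat \<Rightarrow> nat \<Rightarrow> real"
  assume n: "1 \<le> n" and m: "1 \<le> m" and M1: "prob_space M1" and M2: "prob_space M2"
    and indep1: "prob_space.indep_vars M1 (\<lambda>_. borel) \<xi> {1..n}"
    and \<xi>: "\<forall>i\<in>{1..n}. log_gamma_distributed M1 1 2 (\<xi> i)"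
    and indep2: "prob_space.indep_vars M2 (\<lambda>_. borel) \<eta> {1..m}"
    and \<eta>: "\<forall>j\<in>{1..m}. p_stable M2 p (\<eta> j)"
  interpret M1: prob_space M1 by fact
  interpret M2: prob_space M2 by fact
  have I: "{1..n} \<noteq> {}" and J: "{1..m} \<noteq> {}" using n m by auto
  define P where "P k = (\<Pi>\<^sub>M i\<in>{1..k}. (borel :: real measure))" for k :: nat
  define T1 where "T1 \<omega> = (\<lambda>i\<in>{1..n}. \<xi> i \<omega>)" for \<omega>
  define T2 where "T2 \<omega> = (\<lambda>j\<in>{1..m}. \<eta> j \<omega>)" for \<omega>
  define D1 where "D1 = distr M1 (P n) T1"
  define D2 where "D2 = distr M2 (P m) T2"
  note J1 = M1.joint_law_coordinates[OF indep1 I, folded T1_def P_def, folded D1_def]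
  note J2 = M2.joint_law_coordinates[OF indep2 J, folded T2_def P_def, folded D2_def]
  interpret D1: prob_space D1 by (rule J1(1))
  interpret D2: prob_space D2 by (rule J2(1))
  have T1: "T1 \<in> measurable M1 (P n)"
    unfolding T1_def P_def using indep1 by (intro measurable_restrict) (auto simp: M1.indep_vars_def)
  have T2: "T2 \<in> measurable M2 (P m)"
    unfolding T2_def P_def using indep2 by (intro measurable_restrict) (auto simp: M2.indep_vars_def)
  have sets_D: "sets D1 = sets (P n)" "sets D2 = sets (P m)" by (simp_all add: D1_def D2_def)
  have coord: "(\<lambda>x. x i) \<in> borel_measurable (P k)" if "i \<in> {1..k}" for i k
    unfolding P_def using that by (rule measurable_component_singleton)
  have coordD: "(\<lambda>x. x i) \<in> borel_measurable D1" if "i \<in> {1..n}" for i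
    using coord[OF that] sets_D by (simp cong: measurable_cong_sets)
  have coordD2: "(\<lambda>x. x i) \<in> borel_measurable D2" if "i \<in> {1..m}" for i
    using coord[OF that] sets_D by (simp cong: measurable_cong_sets)
  define f where "f x y = ennreal (Max ((\<lambda>(i, j). \<bar>a i j * y j * x i\<bar>) ` ({1..n} \<times> {1..m})))"
    for x y :: "nat \<Rightarrow> real"
  have f_meas: "(\<lambda>(x, y). f x y) \<in> borel_measurable (P n \<Otimes>\<^sub>M P m)"
  proof -
    have "(\<lambda>z. Max ((\<lambda>ij. \<bar>a (fst ij) (snd ij) * snd z (snd ij) * fst z (fst ij)\<bar>) ` ({1..n} \<times> {1..m})))
       \<in> borel_measurable (P n \<Otimes>\<^sub>M P m)"
      by (intro borel_measurable_Max borel_measurable_abs borel_measurable_times borel_measurable_const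
          measurable_compose[OF measurable_fst coord] measurable_compose[OF measurable_snd coord]) auto
    then show ?thesis by (simp add: f_def case_prod_beta)
  qed
  have fx_meas: "f x \<in> borel_measurable (P m)" if "x \<in> space (P n)" for x
    using measurable_compose[OF measurable_Pair1'[OF that] f_meas] by simp
  have "(\<integral>\<^sup>+ x. (\<integral>\<^sup>+ y. f x y \<partial>D2) \<partial>D1) = (\<integral>\<^sup>+ \<omega>1. (\<integral>\<^sup>+ y. f (T1 \<omega>1) y \<partial>D2) \<partial>M1)"
    unfolding D1_def
  proof (rule nn_integral_distr[OF T1])
    have "(\<lambda>(x, y). f x y) \<in> borel_measurable (P n \<Otimes>\<^sub>M D2)"
      using f_meas sets_D by (simp cong: measurable_cong_sets sets_pair_measure_cong)
    then have "(\<lambda>x. \<integral>\<^sup>+ y. f x y \<partial>D2) \<in> borel_measurable (P n)"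
      by (rule D2.borel_measurable_nn_integral)
    then show "(\<lambda>x. \<integral>\<^sup>+ y. f x y \<partial>D2) \<in> borel_measurable (distr M1 (P n) T1)" by simp
  qed
  also have "\<dots> = (\<integral>\<^sup>+ \<omega>1. (\<integral>\<^sup>+ \<omega>2. f (T1 \<omega>1) (T2 \<omega>2) \<partial>M2) \<partial>M1)"
    unfolding D2_def using measurable_space[OF T1]
    by (intro nn_integral_cong nn_integral_distr[OF T2]) (simp add: fx_meas)
  also have "\<dots> = (\<integral>\<^sup>+ \<omega>1. (\<integral>\<^sup>+ \<omega>2.
      ennreal (Max ((\<lambda>(i, j). \<bar>a i j * \<eta> j \<omega>2 * \<xi> i \<omega>1\<bar>) ` ({1..n} \<times> {1..m}))) \<partial>M2) \<partial>M1)"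
    unfolding f_def T1_def T2_def
    by (intro nn_integral_cong arg_cong[where f = ennreal] arg_cong[where f = Max] image_cong) auto
  finally have E: "(\<integral>\<^sup>+ x. (\<integral>\<^sup>+ y. f x y \<partial>D2) \<partial>D1) = \<dots>" .
  have \<xi>': "\<forall>i\<in>{1..n}. log_gamma_distributed D1 1 2 (\<lambda>x. x i)"
  proof
    fix i assume i: "i \<in> {1..n}"
    have "distr D1 lborel (\<lambda>x. x i) = distr D1 borel (\<lambda>x. x i)" by (rule distr_cong) auto
    also have "\<dots> = distr M1 borel (\<xi> i)" using J1(2)[OF i] .
    also have "\<dots> = distr M1 lborel (\<xi> i)" by (rule distr_cong) auto
    finally show "log_gamma_distributed D1 1 2 (\<lambda>x. x i)"
      using \<xi> i coordD[OF i] by (simp add: log_gamma_distributed_def distributed_def)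
  qed
  have \<eta>': "\<forall>j\<in>{1..m}. p_stable D2 p (\<lambda>y. y j)"
    using \<eta> J2(2) coordD2 by (simp add: p_stable_def)
  show "let N = (\<Sum>j=1..m. (\<Sum>i=1..n. \<bar>a i j\<bar>\<^sup>2) powr (p / 2)) powr (1 / p);
           E = (\<integral>\<^sup>+ \<omega>1. (\<integral>\<^sup>+ \<omega>2.
                  ennreal (Max ((\<lambda>(i, j). \<bar>a i j * \<eta> j \<omega>2 * \<xi> i \<omega>1\<bar>) ` ({1..n} \<times> {1..m})))
                  \<partial>M2) \<partial>M1)
       in ennreal (c * N) \<le> E \<and> E \<le> ennreal (C * N)"
    using est[unfolded max_estimate_def, rule_format, OF n m J1(1) J2(1) J1(3) \<xi>'[rule_format]
        J2(3) \<eta>'[rule_format], of a]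
    unfolding E[symmetric] f_def .
qed

theorem theorem3p2:
  fixes p :: real
  assumes "1 < p" and "p < 2"
  shows "(\<exists>c>0. \<exists>C>0. max_estimate TYPE(nat \<Rightarrow> real) TYPE(nat \<Rightarrow> real) p c C) \<and>
    (\<forall>c>0. \<forall>C>0. max_estimate TYPE(nat \<Rightarrow> real) TYPE(nat \<Rightarrow> real) p c C \<longrightarrow>
       max_estimate TYPE('a) TYPE('b) p c C)"
  using max_estimate_exists[OF assms] max_estimate_transfer by blast

end
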